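(* Let $d \ge 1$ and let $\alpha_1,\dots,\alpha_d > 0$ be real numbers with $\alpha_i \notin \mathbb{Z}$ for all $1 \le i \le d$. Let $K_\infty = \prod_{i=1}^d [-\alpha_i,\alpha_i]$ and, for real $p>0$, let $K_p = \{x \in \mathbb{R}^d : \sum_{i=1}^d |x_i/\alpha_i|^p \le 1\}$. Set $$p_0 = \frac{\ln d}{\min_{1 \le i \le d} \ln(\alpha_i/\lfloor \alpha_i \rfloor)}.$$ Then for all real $p > 0$ with $p \ge p_0$, the lattice point set is invariant, i.e. $K_p \cap \mathbb{Z}^d = K_\infty \cap \mathbb{Z}^d$, and in particular $G(K_p, \mathbb{Z}^d) = G(K_\infty, \mathbb{Z}^d)$.
   Context: $G(K,\mathbb{Z}^d) = |K \cap \mathbb{Z}^d|$ is the number of integer lattice points in $K$. Convention: if $\lfloor \alpha_i \rfloor = 0$, then $\ln(\alpha_i/\lfloor\alpha_i\rfloor)$ is interpreted as $+\infty$; if this happens for all $i$, then $p_0 = 0$. *)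

theory Defs
  imports "HOL-Analysis.Analysis"
begin

definition int_lattice :: "(real ^ 'n) set" where
  "int_lattice = {x. \<forall>i. x $ i \<in> \<int>}"

definition lattice_count :: "(real ^ 'n) set \<Rightarrow> (real ^ 'n) set \<Rightarrow> nat" where
  "lattice_count K L = card (K \<inter> L)"

definition K_infty :: "real ^ 'n \<Rightarrow> (real ^ 'n) set" where
  "K_infty \<alpha> = {x. \<forall>i. x $ i \<in> {- (\<alpha> $ i) .. \<alpha> $ i}}"

definition K_p :: "real ^ 'n \<Rightarrow> real \<Rightarrow> (real ^ 'n) set" where
  "K_p \<alpha> p = {x. (\<Sum>i\<in>UNIV. \<bar>x $ i / \<alpha> $ i\<bar> powr p) \<le> 1}"

definition log_ratio :: "real \<Rightarrow> ereal" where
  "log_ratio a = (if \<lfloor>a\<rfloor> = 0 then \<infinity> else ereal (ln (a / of_int \<lfloor>a\<rfloor>)))"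

(* If every floor vanishes, the minimum is \<infinity> and division in ereal yields 0,
   which is the convention for this case. For positive non-integral entries the
   minimum is always > 0, so the junk value of division by 0 does not arise. *)
definition p_zero :: "real ^ 'n \<Rightarrow> ereal" where
  "p_zero \<alpha> = ereal (ln (real CARD('n))) / (MIN i. log_ratio (\<alpha> $ i))"

end

theory Submission
  imports Defs
begin

text \<open>
  The inclusion \<open>K\<^sub>p \<subseteq> K\<^sub>\<infinity>\<close> holds because a sum of nonnegative terms bounded by 1 has every
  term bounded by 1. For the converse on lattice points, integrality sharpens
  \<open>\<bar>x\<^sub>i\<bar> \<le> \<alpha>\<^sub>i\<close> to \<open>\<bar>x\<^sub>i\<bar> \<le> \<lfloor>\<alpha>\<^sub>i\<rfloor>\<close>, and \<open>p\<^sub>0\<close> is exactly the exponent from which on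
  \<open>(\<lfloor>\<alpha>\<^sub>i\<rfloor> / \<alpha>\<^sub>i) powr p \<le> 1 / d\<close> holds in every coordinate with \<open>\<lfloor>\<alpha>\<^sub>i\<rfloor> \<noteq> 0\<close>: taking logarithms,
  this bound says \<open>ln d \<le> p * ln (\<alpha>\<^sub>i / \<lfloor>\<alpha>\<^sub>i\<rfloor>)\<close> (lemma \<open>ln_dim_le_of_p_zero_le\<close>). Coordinates
  with \<open>\<lfloor>\<alpha>\<^sub>i\<rfloor> = 0\<close> force \<open>x\<^sub>i = 0\<close> and contribute nothing. Hence each of the \<open>d\<close> terms is at most
  \<open>1 / d\<close>, and their sum is at most 1.
\<close>

lemma K_p_subset_K_infty:
  fixes \<alpha> :: "real ^ 'n"
  assumes pos: "\<And>i. \<alpha> $ i > 0" and p: "p > 0"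
  shows "K_p \<alpha> p \<subseteq> K_infty \<alpha>"
proof
  fix x assume x: "x \<in> K_p \<alpha> p"
  have "\<bar>x $ i\<bar> \<le> \<alpha> $ i" for i
  proof -
    have "\<bar>x $ i / \<alpha> $ i\<bar> powr p \<le> (\<Sum>i\<in>UNIV. \<bar>x $ i / \<alpha> $ i\<bar> powr p)"
      by (rule member_le_sum) auto
    also have "\<dots> \<le> 1"
      using x by (simp add: K_p_def)
    finally have "\<not> \<bar>x $ i / \<alpha> $ i\<bar> > 1"
      using gr_one_powr[OF _ p, of "\<bar>x $ i / \<alpha> $ i\<bar>"] by linarith
    then show ?thesis
      using pos[of i] by (simp add: divide_simps abs_of_pos split: if_splits)
  qed
  then show "x \<in> K_infty \<alpha>"
    by (auto simp: K_infty_def abs_le_iff minus_le_iff)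
qed

text \<open>
  Non-integrality makes \<open>\<alpha>\<^sub>i / \<lfloor>\<alpha>\<^sub>i\<rfloor>\<close> strictly larger than 1. The minimum defining \<open>p\<^sub>0\<close> is
  therefore positive, so that one may multiply by it.
\<close>

lemma log_ratio_pos:
  assumes "a > 0" "a \<notin> \<int>"
  shows "log_ratio a > 0"
proof (cases "\<lfloor>a\<rfloor> = 0")
  case False
  then have "of_int \<lfloor>a\<rfloor> > (0::real)" 
    using assms(1) by (simp add: order_less_le)
  moreover have "of_int \<lfloor>a\<rfloor> < a"
    using assms(2) by (metis Ints_of_int of_int_floor_le order_less_le)
  ultimately show ?thesis
    using False by (simp add: log_ratio_def)
qed (simp add: log_ratio_def)

lemma ln_dim_le_of_p_zero_le:
  fixes \<alpha> :: "real ^ 'n"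
  assumes pos: "\<And>i. \<alpha> $ i > 0" and nonint: "\<And>i. \<alpha> $ i \<notin> \<int>"
    and p: "p > 0" and p0: "p_zero \<alpha> \<le> ereal p" and floor: "\<lfloor>\<alpha> $ i\<rfloor> \<noteq> 0"
  shows "ln (real CARD('n)) \<le> p * ln (\<alpha> $ i / of_int \<lfloor>\<alpha> $ i\<rfloor>)"
proof -
  define M where "M = (MIN i. log_ratio (\<alpha> $ i))"
  have "M > 0"
    unfolding M_def using log_ratio_pos[OF pos nonint] by simp
  moreover have "M \<le> log_ratio (\<alpha> $ i)"
    unfolding M_def by (rule Min_le) auto
  then have le: "M \<le> ereal (ln (\<alpha> $ i / of_int \<lfloor>\<alpha> $ i\<rfloor>))"
    using floor by (simp add: log_ratio_def)
  ultimately obtain m where m: "M = ereal m" "m > 0"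
    by (cases M) auto
  have "ln (real CARD('n)) / m \<le> p"
    using p0 m by (simp add: p_zero_def M_def[symmetric])
  then have "ln (real CARD('n)) \<le> p * m"
    using m by (simp add: pos_divide_le_eq)
  also have "\<dots> \<le> p * ln (\<alpha> $ i / of_int \<lfloor>\<alpha> $ i\<rfloor>)"
    using le m p by (simp add: mult_left_mono)
  finally show ?thesis .
qed

lemma lattice_K_infty_subset_K_p:
  fixes \<alpha> :: "real ^ 'n"
  assumes pos: "\<And>i. \<alpha> $ i > 0" and nonint: "\<And>i. \<alpha> $ i \<notin> \<int>"
    and p: "p > 0" and p0: "p_zero \<alpha> \<le> ereal p"
  shows "K_infty \<alpha> \<inter> int_lattice \<subseteq> K_p \<alpha> p"
proof
  fix x assume x: "x \<in> K_infty \<alpha> \<inter> int_lattice"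
  have "\<bar>x $ i / \<alpha> $ i\<bar> powr p \<le> 1 / real CARD('n)" for i
  proof (cases "x $ i = 0")
    case False
    define f :: real where "f = of_int \<lfloor>\<alpha> $ i\<rfloor>"
    obtain k where k: "x $ i = of_int k"
      using x by (auto simp: int_lattice_def elim: Ints_cases)
    have "\<bar>x $ i\<bar> \<le> \<alpha> $ i"
      using x by (auto simp: K_infty_def abs_le_iff minus_le_iff)
    then have "\<bar>k\<bar> \<le> \<lfloor>\<alpha> $ i\<rfloor>"
      using k by (simp add: le_floor_iff)
    moreover have "k \<noteq> 0"
      using False k by simp
    ultimately have floor: "\<lfloor>\<alpha> $ i\<rfloor> > 0"
      by linarith
    then have f: "f > 0"
      by (simp add: f_def)
    have "\<bar>x $ i\<bar> \<le> f"
      using \<open>\<bar>k\<bar> \<le> \<lfloor>\<alpha> $ i\<rfloor>\<close> k by (simp add: f_def flip: of_int_abs)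
    then have "\<bar>x $ i / \<alpha> $ i\<bar> \<le> f / \<alpha> $ i"
      using pos[of i] by (simp add: divide_right_mono)
    then have "\<bar>x $ i / \<alpha> $ i\<bar> powr p \<le> (f / \<alpha> $ i) powr p"
      using p by (simp add: powr_mono2)
    also have "\<dots> = exp (- (p * ln (\<alpha> $ i / f)))"
      using f pos[of i] by (simp add: powr_def ln_div algebra_simps)
    also have "\<dots> \<le> exp (- ln (real CARD('n)))"
      using ln_dim_le_of_p_zero_le[OF pos nonint p p0, of i] floor by (simp add: f_def)
    also have "\<dots> = 1 / real CARD('n)"
      by (simp add: exp_minus inverse_eq_divide)
    finally show ?thesis .
  qed simp
  then have "(\<Sum>i\<in>UNIV. \<bar>x $ i / \<alpha> $ i\<bar> powr p) \<le> (\<Sum>i\<in>(UNIV :: 'n set). 1 / real CARD('n))"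
    by (rule sum_mono)
  then show "x \<in> K_p \<alpha> p"
    by (simp add: K_p_def)
qed

theorem theorem7:
  fixes \<alpha> :: "real ^ 'n" and p :: real
  assumes "\<And>i. \<alpha> $ i > 0"
    and "\<And>i. \<alpha> $ i \<notin> \<int>"
    and "p > 0"
    and "ereal p \<ge> p_zero \<alpha>"
  shows "K_p \<alpha> p \<inter> int_lattice = K_infty \<alpha> \<inter> int_lattice
    \<and> lattice_count (K_p \<alpha> p) int_lattice = lattice_count (K_infty \<alpha>) int_lattice"
proof -
  have "K_p \<alpha> p \<inter> int_lattice = K_infty \<alpha> \<inter> int_lattice"
    using K_p_subset_K_infty[OF assms(1,3)] lattice_K_infty_subset_K_p[OF assms] by blast
  then show ?thesis
    by (simp add: lattice_count_def)
qed

end
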